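(* Let $k$ be an algebraically closed field. Suppose the objects $(A\subset B)$ and $(\widetilde A\subset\widetilde B)$ of $\mathcal S$ have LR-tableaux $\Gamma$ and $\widetilde\Gamma$, respectively, of the same shape $(\alpha,\beta,\gamma)$. The following assertions are equivalent: 1. $\Gamma\leq_{\sf dom}\widetilde\Gamma$. 2. For each picket $P_i^\ell$ the inequality $$\dim\mathrm{Hom}_{\mathcal S}((A\subset B),P_i^\ell)\le\dim\mathrm{Hom}_{\mathcal S}((\widetilde A\subset\widetilde B),P_i^\ell)$$ holds.
   Context: Partitions $\alpha=(\alpha_1\ge\dots\ge\alpha_s)$ are padded by zeros if needed; the transpose is $\alpha'_j=\#\{i:\alpha_i\ge j\}$. Natural partial order: $\alpha\leq_{\sf nat}\widetilde\alpha$ if $\alpha'_1+\dots+\alpha'_j\le\widetilde\alpha'_1+\dots+\widetilde\alpha'_j$ for each $j$. For a partition $\alpha$, $N_\alpha=\bigoplus_i k[T]/(T^{\alpha_i})$. $\mathcal S$ is the category of embeddings (invariant subspaces of nilpotent operators): objects are pairs $(A\subset B)$ with $B$ a finite-dimensional $k[T]$-module on which $T$ acts nilpotently and $A\subseteq B$ a $k[T]$-submodule; a morphism $(A\subset B)\to(A'\subset B')$ is a $k[T]$-linear map $\varphi:B\to B'$ with $\varphi(A)\subseteq A'$. The picket $P_i^\ell$ ($\ell\ge1$, $0\le i\le\ell$) is the object $\big((T^{\ell-i})\subset k[T]/(T^\ell)\big)$. If $A\cong N_\alpha$, $B\cong N_\beta$, $B/A\cong N_\gamma$, the LR-tableau of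 $(A\subset B)$ has shape $(\alpha,\beta,\gamma)$ and is the sequence of partitions $\Gamma=[\gamma^{(0)},\dots,\gamma^{(t)}]$, $t=\alpha_1$, given by $B/T^iA\cong N_{\gamma^{(i)}}$. For LR-tableaux $\Gamma=[\gamma^{(0)},\dots,\gamma^{(t)}]$ and $\widetilde\Gamma=[\widetilde\gamma^{(0)},\dots,\widetilde\gamma^{(t)}]$ of the same shape, $\Gamma\leq_{\sf dom}\widetilde\Gamma$ means $\gamma^{(i)}\leq_{\sf nat}\widetilde\gamma^{(i)}$ for each $i$. *)

theory Defs
  imports "Jordan_Normal_Form.VS_Connect" "HOL-Algebra.Ideal"
begin

text \<open>Throughout, \<open>k\<close> is a field type \<open>'a\<close>, the ring \<open>k[T]\<close> is the type \<open>'a poly\<close>, seen as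
  the ring \<open>class_ring\<close> with full carrier, and a \<open>k[T]\<close>-module is an HOL-Algebra module over it.
  Module records inherit the fields \<open>mult\<close> and \<open>one\<close> from rings; no definition below refers to
  them, and they are filled with zeros.\<close>

subsection \<open>Constructions with modules\<close>

definition quot_module :: "('r, 'b) module \<Rightarrow> 'b set \<Rightarrow> ('r, 'b set) module" where
  "quot_module M N = \<lparr>carrier = a_rcosets\<^bsub>M\<^esub> N, mult = (\<lambda>_ _. N), one = N, zero = N,
     add = (\<lambda>X Y. X <+>\<^bsub>M\<^esub> Y), smult = (\<lambda>r X. \<Union>x\<in>X. N +>\<^bsub>M\<^esub> (r \<odot>\<^bsub>M\<^esub> x))\<rparr>"

text \<open>The direct product of a family; used for finite \<open>I\<close> only, where it is the direct sum.\<close>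
definition product_module :: "'i set \<Rightarrow> ('i \<Rightarrow> ('r, 'b) module) \<Rightarrow> ('r, 'i \<Rightarrow> 'b) module" where
  "product_module I M = \<lparr>carrier = (\<Pi>\<^sub>E i\<in>I. carrier (M i)),
     mult = (\<lambda>_ _. \<lambda>i\<in>I. \<zero>\<^bsub>M i\<^esub>), one = (\<lambda>i\<in>I. \<zero>\<^bsub>M i\<^esub>), zero = (\<lambda>i\<in>I. \<zero>\<^bsub>M i\<^esub>),
     add = (\<lambda>x y. \<lambda>i\<in>I. x i \<oplus>\<^bsub>M i\<^esub> y i), smult = (\<lambda>r x. \<lambda>i\<in>I. r \<odot>\<^bsub>M i\<^esub> x i)\<rparr>"

definition module_iso ::
  "('a::field poly, 'b) module \<Rightarrow> ('a poly, 'c) module \<Rightarrow> bool" (infix \<open>\<cong>\<^sub>T\<close> 50) where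
  "M \<cong>\<^sub>T N \<longleftrightarrow> (\<exists>f \<in> LinearCombinations.module_hom class_ring M N. bij_betw f (carrier M) (carrier N))"

definition restrict_scalars :: "('a::field poly, 'b) module \<Rightarrow> ('a, 'b) module" where
  "restrict_scalars M = \<lparr>carrier = carrier M, mult = (\<lambda>_ _. \<zero>\<^bsub>M\<^esub>), one = \<zero>\<^bsub>M\<^esub>, zero = \<zero>\<^bsub>M\<^esub>,
     add = (\<lambda>x y. x \<oplus>\<^bsub>M\<^esub> y), smult = (\<lambda>c x. [:c:] \<odot>\<^bsub>M\<^esub> x)\<rparr>"

definition regular_module :: "('a::field poly, 'a poly) module" where
  "regular_module = \<lparr>carrier = UNIV, mult = (\<lambda>_ _. 0), one = 0, zero = 0, add = (+), smult = (*)\<rparr>"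

abbreviation T_ideal :: "nat \<Rightarrow> 'a::field poly set" where
  "T_ideal n \<equiv> PIdl\<^bsub>class_ring\<^esub> (monom 1 n)"

text \<open>\<open>k[T]/(T\<^sup>n)\<close>\<close>
definition cyclic_module :: "nat \<Rightarrow> ('a::field poly, 'a poly set) module" where
  "cyclic_module n = quot_module regular_module (T_ideal n)"

subsection \<open>Partitions\<close>

text \<open>A partition is represented by the list of its nonzero parts.\<close>
definition is_partition :: "nat list \<Rightarrow> bool" where
  "is_partition \<alpha> \<longleftrightarrow> sorted_wrt (\<ge>) \<alpha> \<and> 0 \<notin> set \<alpha>"

text \<open>\<open>\<alpha>\<^sub>1\<close>, which is \<open>0\<close> for the empty partition.\<close>
definition first_part :: "nat list \<Rightarrow> nat" where
  "first_part \<alpha> = (case \<alpha> of [] \<Rightarrow> 0 | a # _ \<Rightarrow> a)"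

definition transpose_part :: "nat list \<Rightarrow> nat \<Rightarrow> nat" where
  "transpose_part \<alpha> j = card {i. i < length \<alpha> \<and> \<alpha> ! i \<ge> j}"

definition nat_le :: "nat list \<Rightarrow> nat list \<Rightarrow> bool" (infix \<open>\<le>\<^sub>n\<^sub>a\<^sub>t\<close> 50) where
  "\<alpha> \<le>\<^sub>n\<^sub>a\<^sub>t \<alpha>' \<longleftrightarrow> (\<forall>j. (\<Sum>r=1..j. transpose_part \<alpha> r) \<le> (\<Sum>r=1..j. transpose_part \<alpha>' r))"

definition nilp_module :: "nat list \<Rightarrow> ('a::field poly, nat \<Rightarrow> 'a poly set) module" where
  "nilp_module \<alpha> = product_module {..<length \<alpha>} (\<lambda>i. cyclic_module (\<alpha> ! i))"

subsection \<open>The category of embeddings\<close>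

type_synonym ('a, 'b) emb = "'b set \<times> ('a poly, 'b) module"

definition embedding :: "('a::field, 'b) emb \<Rightarrow> bool" where
  "embedding X \<longleftrightarrow> (case X of (A, B) \<Rightarrow>
     module class_ring B \<and>
     vectorspace.fin_dim class_ring (restrict_scalars B) \<and>
     (\<exists>n. \<forall>b\<in>carrier B. monom 1 n \<odot>\<^bsub>B\<^esub> b = \<zero>\<^bsub>B\<^esub>) \<and>
     LinearCombinations.submodule class_ring A B)"

text \<open>Morphisms are taken extensional, so that two of them are equal iff they agree on the
  carrier of the source.\<close>
definition Hom_S :: "('a::field, 'b) emb \<Rightarrow> ('a, 'c) emb \<Rightarrow> ('b \<Rightarrow> 'c) set" where
  "Hom_S X Y = (case (X, Y) of ((A, B), (A', B')) \<Rightarrow>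
     {\<phi> \<in> LinearCombinations.module_hom class_ring B B'. \<phi> \<in> extensional (carrier B) \<and> \<phi> ` A \<subseteq> A'})"

definition Hom_space :: "('a::field, 'b) emb \<Rightarrow> ('a, 'c) emb \<Rightarrow> ('a, 'b \<Rightarrow> 'c) module" where
  "Hom_space X Y = (case (X, Y) of ((A, B), (A', B')) \<Rightarrow>
     \<lparr>carrier = Hom_S X Y,
      mult = (\<lambda>_ _. \<lambda>b\<in>carrier B. \<zero>\<^bsub>B'\<^esub>), one = (\<lambda>b\<in>carrier B. \<zero>\<^bsub>B'\<^esub>),
      zero = (\<lambda>b\<in>carrier B. \<zero>\<^bsub>B'\<^esub>),
      add = (\<lambda>\<phi> \<psi>. \<lambda>b\<in>carrier B. \<phi> b \<oplus>\<^bsub>B'\<^esub> \<psi> b),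
      smult = (\<lambda>c \<phi>. \<lambda>b\<in>carrier B. [:c:] \<odot>\<^bsub>B'\<^esub> \<phi> b)\<rparr>)"

abbreviation dim_Hom :: "('a::field, 'b) emb \<Rightarrow> ('a, 'c) emb \<Rightarrow> nat" where
  "dim_Hom X Y \<equiv> vectorspace.dim class_ring (Hom_space X Y)"

text \<open>\<open>picket i l\<close> is \<open>P\<^sub>i\<^sup>l\<close>; its submodule consists of the \<open>k[T]\<close>-multiples of the class of
  \<open>T\<close> to the power \<open>l - i\<close>.  It is meaningful for \<open>i \<le> l\<close>.\<close>
definition picket :: "nat \<Rightarrow> nat \<Rightarrow> ('a::field, 'a poly set) emb" where
  "picket i l =
     (range (\<lambda>p. p \<odot>\<^bsub>cyclic_module l\<^esub> (T_ideal l +>\<^bsub>regular_module\<^esub> monom 1 (l - i))),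
      cyclic_module l)"

subsection \<open>LR-tableaux\<close>

definition has_shape :: "('a::field, 'b) emb \<Rightarrow> nat list \<Rightarrow> nat list \<Rightarrow> nat list \<Rightarrow> bool" where
  "has_shape X \<alpha> \<beta> \<gamma> \<longleftrightarrow> (case X of (A, B) \<Rightarrow>
     is_partition \<alpha> \<and> is_partition \<beta> \<and> is_partition \<gamma> \<and>
     B\<lparr>carrier := A\<rparr> \<cong>\<^sub>T nilp_module \<alpha> \<and>
     B \<cong>\<^sub>T nilp_module \<beta> \<and>
     quot_module B A \<cong>\<^sub>T nilp_module \<gamma>)"

text \<open>The list \<open>\<Gamma>\<close> is indexed from \<open>0\<close> to \<open>t = first_part \<alpha>\<close>.\<close>
definition has_LR_tableau ::
  "('a::field, 'b) emb \<Rightarrow> nat list \<Rightarrow> nat list \<Rightarrow> nat list \<Rightarrow> nat list list \<Rightarrow> bool" where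
  "has_LR_tableau X \<alpha> \<beta> \<gamma> \<Gamma> \<longleftrightarrow> has_shape X \<alpha> \<beta> \<gamma> \<and>
     length \<Gamma> = Suc (first_part \<alpha>) \<and>
     (case X of (A, B) \<Rightarrow> \<forall>i \<le> first_part \<alpha>. is_partition (\<Gamma> ! i) \<and>
        quot_module B ((\<lambda>a. monom 1 i \<odot>\<^bsub>B\<^esub> a) ` A) \<cong>\<^sub>T nilp_module (\<Gamma> ! i))"

definition dom_le :: "nat list list \<Rightarrow> nat list list \<Rightarrow> bool" (infix \<open>\<le>\<^sub>d\<^sub>o\<^sub>m\<close> 50) where
  "\<Gamma> \<le>\<^sub>d\<^sub>o\<^sub>m \<Gamma>' \<longleftrightarrow> list_all2 (\<le>\<^sub>n\<^sub>a\<^sub>t) \<Gamma> \<Gamma>'"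

end

theory Submission
  imports Defs
begin

text \<open>A morphism \<open>(A \<subset> B) \<rightarrow> P\<^sub>i\<^sup>l\<close> is a homomorphism \<open>B \<rightarrow> k[T]/(T\<^sup>l)\<close> killing \<open>T\<^sup>iA\<close>, so the Hom space is
  that of \<open>B/T\<^sup>iA\<close> to \<open>k[T]/(T\<^sup>l)\<close>, and its dimension is the sum of the first \<open>l\<close> parts of the transpose of
  the partition of \<open>B/T\<^sup>iA\<close>.  Hence (2) compares the same partial sums as (1), apart from those with
  \<open>l < i\<close>; but \<open>T\<^sup>i\<close> and \<open>T\<^sup>l\<close> both annihilate \<open>k[T]/(T\<^sup>l)\<close> then, so these are governed by the picket \<open>P\<^sub>l\<^sup>l\<close>.\<close>

section \<open>Quotients of modules by submodules\<close>

text \<open>Closure under negation follows from -x = (-1)x. This opens the coset calculus of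
  \<open>abelian_subgroup\<close> to quotients by submodules.\<close>

lemma submodule_abelian_subgroup:
  assumes "module R M" "submodule R N M"
  shows "abelian_subgroup N M"
proof -
  interpret M: Module.module R M by fact
  interpret N: LinearCombinations.submodule R N M by fact
  have minus: "\<ominus>\<^bsub>M\<^esub> x \<in> N" if "x \<in> N" for x
  proof -
    have "\<ominus>\<^bsub>M\<^esub> x = (\<ominus>\<^bsub>R\<^esub> \<one>\<^bsub>R\<^esub>) \<odot>\<^bsub>M\<^esub> x"
      using that N.subset by (simp add: M.smult_l_minus subset_iff)
    then show ?thesis using that by simp
  qed
  have "subgroup N (add_monoid M)"
  proof (rule M.add.subgroupI)
    show "N \<noteq> {}" using N.zero_closed by blast
  qed (use minus N.subset in auto)
  then show ?thesis
    by (intro abelian_subgroupI3 M.abelian_group_axioms additive_subgroup.intro)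
qed

context
  fixes R :: "('r, 's) ring_scheme" and M :: "('r, 'b) module" and N
  assumes M: "module R M" and N: "submodule R N M"
begin

interpretation M: Module.module R M by (fact M)
interpretation N: LinearCombinations.submodule R N M by (fact N)
interpretation G: abelian_subgroup N M by (rule submodule_abelian_subgroup[OF M N])

lemma quot_module_carrier: "carrier (quot_module M N) = (\<lambda>x. N +>\<^bsub>M\<^esub> x) ` carrier M"
  by (auto simp: quot_module_def A_RCOSETS_def')

lemma quot_module_zero: "\<zero>\<^bsub>quot_module M N\<^esub> = N +>\<^bsub>M\<^esub> \<zero>\<^bsub>M\<^esub>"
  by (simp add: quot_module_def N.subset)

lemma quot_module_eq_iff:
  assumes "x \<in> carrier M" "y \<in> carrier M"
  shows "N +>\<^bsub>M\<^esub> x = N +>\<^bsub>M\<^esub> y \<longleftrightarrow> x \<ominus>\<^bsub>M\<^esub> y \<in> N"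
proof -
  have "x \<in> N +>\<^bsub>M\<^esub> y" if "N +>\<^bsub>M\<^esub> x = N +>\<^bsub>M\<^esub> y"
    using G.a_rcos_self[OF assms(1)] that by simp
  moreover have "N +>\<^bsub>M\<^esub> x = N +>\<^bsub>M\<^esub> y" if "x \<in> N +>\<^bsub>M\<^esub> y"
    using M.a_repr_independence[OF that assms(2) G.a_subgroup] by simp
  ultimately show ?thesis
    using G.a_rcos_module[OF assms(2,1)] by (auto simp: a_minus_def)
qed

lemma quot_module_add:
  assumes "x \<in> carrier M" "y \<in> carrier M"
  shows "(N +>\<^bsub>M\<^esub> x) \<oplus>\<^bsub>quot_module M N\<^esub> (N +>\<^bsub>M\<^esub> y) = N +>\<^bsub>M\<^esub> (x \<oplus>\<^bsub>M\<^esub> y)"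
  using assms by (simp add: quot_module_def G.a_rcos_sum)

text \<open>The scalar action is defined as a union over all representatives. The cosets of
  \<open>r y\<close> all coincide, because r(y - x) lies in \<open>N\<close>, and a coset is
  nonempty, so the union is that single coset.\<close>

lemma quot_module_smult:
  assumes "r \<in> carrier R" "x \<in> carrier M"
  shows "r \<odot>\<^bsub>quot_module M N\<^esub> (N +>\<^bsub>M\<^esub> x) = N +>\<^bsub>M\<^esub> (r \<odot>\<^bsub>M\<^esub> x)"
proof -
  have "N +>\<^bsub>M\<^esub> (r \<odot>\<^bsub>M\<^esub> y) = N +>\<^bsub>M\<^esub> (r \<odot>\<^bsub>M\<^esub> x)" if y: "y \<in> N +>\<^bsub>M\<^esub> x" for y
  proof -
    have yM: "y \<in> carrier M" using y assms G.a_elemrcos_carrier by blast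
    have "y \<oplus>\<^bsub>M\<^esub> \<ominus>\<^bsub>M\<^esub> x \<in> N" using G.a_rcos_module_imp[OF assms(2) y] .
    then have "r \<odot>\<^bsub>M\<^esub> (y \<oplus>\<^bsub>M\<^esub> \<ominus>\<^bsub>M\<^esub> x) \<in> N" using assms by simp
    moreover have "r \<odot>\<^bsub>M\<^esub> (y \<oplus>\<^bsub>M\<^esub> \<ominus>\<^bsub>M\<^esub> x) = r \<odot>\<^bsub>M\<^esub> y \<ominus>\<^bsub>M\<^esub> r \<odot>\<^bsub>M\<^esub> x"
      using assms yM by (simp add: M.smult_r_distr M.smult_r_minus a_minus_def)
    ultimately show ?thesis using assms yM by (simp add: quot_module_eq_iff)
  qed
  moreover have "x \<in> N +>\<^bsub>M\<^esub> x" using assms G.a_rcos_self by blast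
  ultimately have "(\<Union>y\<in>N +>\<^bsub>M\<^esub> x. N +>\<^bsub>M\<^esub> (r \<odot>\<^bsub>M\<^esub> y)) = N +>\<^bsub>M\<^esub> (r \<odot>\<^bsub>M\<^esub> x)"
    by blast
  then show ?thesis by (simp add: quot_module_def)
qed

lemma quot_module_module: "module R (quot_module M N)"
proof (rule moduleI)
  show "abelian_group (quot_module M N)"
  proof (rule abelian_groupI)
    fix X assume "X \<in> carrier (quot_module M N)"
    then obtain x where x: "x \<in> carrier M" "X = N +>\<^bsub>M\<^esub> x" by (auto simp: quot_module_carrier)
    show "\<exists>Y\<in>carrier (quot_module M N). Y \<oplus>\<^bsub>quot_module M N\<^esub> X = \<zero>\<^bsub>quot_module M N\<^esub>"
      using x by (intro bexI[of _ "N +>\<^bsub>M\<^esub> (\<ominus>\<^bsub>M\<^esub> x)"])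
        (auto simp: quot_module_carrier quot_module_zero quot_module_add M.l_neg)
  qed (auto simp: quot_module_carrier quot_module_zero quot_module_add M.a_ac)
next
  fix r X assume r: "r \<in> carrier R" and "X \<in> carrier (quot_module M N)"
  then obtain x where x: "x \<in> carrier M" "X = N +>\<^bsub>M\<^esub> x" by (auto simp: quot_module_carrier)
  show "r \<odot>\<^bsub>quot_module M N\<^esub> X \<in> carrier (quot_module M N)"
    unfolding x(2) quot_module_smult[OF r x(1)] quot_module_carrier using r x(1) by blast
  fix s assume s: "s \<in> carrier R"
  show "(r \<oplus>\<^bsub>R\<^esub> s) \<odot>\<^bsub>quot_module M N\<^esub> X
      = r \<odot>\<^bsub>quot_module M N\<^esub> X \<oplus>\<^bsub>quot_module M N\<^esub> s \<odot>\<^bsub>quot_module M N\<^esub> X"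
    using r s x by (simp add: quot_module_smult quot_module_add M.smult_l_distr)
  show "(r \<otimes>\<^bsub>R\<^esub> s) \<odot>\<^bsub>quot_module M N\<^esub> X
      = r \<odot>\<^bsub>quot_module M N\<^esub> (s \<odot>\<^bsub>quot_module M N\<^esub> X)"
    using r s x by (simp add: quot_module_smult M.smult_assoc1)
next
  fix r X Y
  assume r: "r \<in> carrier R" and "X \<in> carrier (quot_module M N)" "Y \<in> carrier (quot_module M N)"
  then obtain x y where "x \<in> carrier M" "X = N +>\<^bsub>M\<^esub> x" "y \<in> carrier M" "Y = N +>\<^bsub>M\<^esub> y"
    by (auto simp: quot_module_carrier)
  then show "r \<odot>\<^bsub>quot_module M N\<^esub> (X \<oplus>\<^bsub>quot_module M N\<^esub> Y)
      = r \<odot>\<^bsub>quot_module M N\<^esub> X \<oplus>\<^bsub>quot_module M N\<^esub> r \<odot>\<^bsub>quot_module M N\<^esub> Y"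
    using r by (simp add: quot_module_smult quot_module_add M.smult_r_distr)
next
  fix X assume "X \<in> carrier (quot_module M N)"
  then show "\<one>\<^bsub>R\<^esub> \<odot>\<^bsub>quot_module M N\<^esub> X = X"
    by (auto simp: quot_module_carrier quot_module_smult)
qed (rule M.is_cring)

end

section \<open>The cyclic modules k[T]/(T^n)\<close>

lemma regular_module_module: "module class_ring (regular_module :: ('a::field poly, 'a poly) module)"
proof (rule moduleI)
  show "cring (class_ring :: 'a poly ring)" by (rule class_cring.is_cring)
  show "abelian_group (regular_module :: ('a poly, 'a poly) module)"
  proof (rule abelian_groupI)
    fix x :: "'a poly"
    show "\<exists>y\<in>carrier regular_module. y \<oplus>\<^bsub>regular_module\<^esub> x = \<zero>\<^bsub>regular_module\<^esub>"
      by (rule bexI[of _ "- x"]) (simp_all add: regular_module_def)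
  qed (simp_all add: regular_module_def add.assoc add.commute)
next
  fix a b x :: "'a poly"
  show "(a \<oplus>\<^bsub>class_ring\<^esub> b) \<odot>\<^bsub>regular_module\<^esub> x
      = a \<odot>\<^bsub>regular_module\<^esub> x \<oplus>\<^bsub>regular_module\<^esub> b \<odot>\<^bsub>regular_module\<^esub> x"
    by (simp add: regular_module_def distrib_right)
  show "(a \<otimes>\<^bsub>class_ring\<^esub> b) \<odot>\<^bsub>regular_module\<^esub> x
      = a \<odot>\<^bsub>regular_module\<^esub> (b \<odot>\<^bsub>regular_module\<^esub> x)"
    by (simp add: regular_module_def mult.assoc)
qed (simp_all add: regular_module_def distrib_left)

lemma T_ideal_eq: "T_ideal n = {p :: 'a::field poly. monom 1 n dvd p}"
  unfolding cgenideal_def dvd_def by (simp add: mult.commute[of _ "monom 1 n"])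

lemma T_ideal_submodule: "submodule class_ring (T_ideal n) (regular_module :: ('a::field poly, 'a poly) module)"
  unfolding T_ideal_eq
proof (rule LinearCombinations.submodule.intro)
  show "module class_ring (regular_module :: ('a poly, 'a poly) module)"
    by (rule regular_module_module)
qed (simp_all add: regular_module_def)

definition T_class :: "nat \<Rightarrow> 'a::field poly \<Rightarrow> 'a poly set" where
  "T_class n p = T_ideal n +>\<^bsub>regular_module\<^esub> p"

text \<open>Turns equations in k[T]/(T^n) into divisibility of polynomials, the form in which they
  are handled from here on.\<close>

lemma T_class_eq_iff: "T_class n p = T_class n q \<longleftrightarrow> monom 1 n dvd p - q"
proof -
  have *: "T_class n p = {r. monom 1 n dvd r - p}" for p :: "'a poly"
  proof (rule Set.set_eqI)
    fix r
    have "r \<in> T_class n p \<longleftrightarrow> (\<exists>d. monom 1 n dvd d \<and> r = d + p)"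
      unfolding T_class_def T_ideal_eq a_r_coset_def' by (simp add: regular_module_def)
    also have "\<dots> \<longleftrightarrow> monom 1 n dvd r - p"
      by (metis add_diff_cancel_right' diff_add_cancel)
    finally show "r \<in> T_class n p \<longleftrightarrow> r \<in> {r. monom 1 n dvd r - p}" by simp
  qed
  have "monom 1 n dvd p - q" if "T_class n p = T_class n q"
  proof -
    have "p \<in> T_class n p" unfolding * by simp
    then show ?thesis unfolding that unfolding * by simp
  qed
  moreover have "T_class n p = T_class n q" if d: "monom 1 n dvd p - q"
  proof -
    have "monom 1 n dvd r - p \<longleftrightarrow> monom 1 n dvd r - q" for r
      using dvd_add_left_iff[OF d, of "r - p"] by simp
    then show ?thesis unfolding * by simp
  qed
  ultimately show ?thesis by blast
qed

lemma cyclic_module_carrier: "carrier (cyclic_module n) = range (T_class n)"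
  unfolding cyclic_module_def T_class_def
  by (simp add: quot_module_carrier[OF regular_module_module T_ideal_submodule])
    (simp add: regular_module_def)

lemma cyclic_module_zero: "\<zero>\<^bsub>cyclic_module n\<^esub> = T_class n 0"
  unfolding cyclic_module_def T_class_def
  by (simp add: quot_module_zero[OF regular_module_module T_ideal_submodule])
    (simp add: regular_module_def)

lemma cyclic_module_add:
  "T_class n p \<oplus>\<^bsub>cyclic_module n\<^esub> T_class n q = T_class n (p + q)"
  using quot_module_add[OF regular_module_module T_ideal_submodule, of p q n]
  unfolding cyclic_module_def T_class_def by (simp add: regular_module_def)

lemma cyclic_module_smult:
  "r \<odot>\<^bsub>cyclic_module n\<^esub> T_class n p = T_class n (r * p)"
  using quot_module_smult[OF regular_module_module T_ideal_submodule, of r p n]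
  unfolding cyclic_module_def T_class_def by (simp add: regular_module_def)

lemma cyclic_module_module: "module class_ring (cyclic_module n)"
  unfolding cyclic_module_def
  by (rule quot_module_module[OF regular_module_module T_ideal_submodule])

section \<open>Polynomial coordinates on a quotient of type \<gamma>\<close>

text \<open>\<open>\<rho> x j\<close> is a polynomial representing, modulo \<open>T\<close> to the power \<open>\<gamma>\<^sub>j\<close>, the \<open>j\<close>-th coordinate of the class of
  \<open>x\<close> under an isomorphism of \<open>B/N\<close> with the module \<open>N\<^sub>\<gamma>\<close>.\<close>
locale T_coordinates = Module.module "class_ring :: ('a::field) poly ring" B
  for B :: "(('a::field) poly, 'b) module" (structure) +
  fixes N :: "'b set" and \<gamma> :: "nat list" and \<rho> :: "'b \<Rightarrow> nat \<Rightarrow> ('a::field) poly"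
  assumes coord_add: "\<lbrakk>x \<in> carrier B; y \<in> carrier B; j < length \<gamma>\<rbrakk> \<Longrightarrow>
      monom 1 (\<gamma> ! j) dvd \<rho> (x \<oplus> y) j - (\<rho> x j + \<rho> y j)"
    and coord_smult: "\<lbrakk>x \<in> carrier B; j < length \<gamma>\<rbrakk> \<Longrightarrow>
      monom 1 (\<gamma> ! j) dvd \<rho> (r \<odot> x) j - r * \<rho> x j"
    and kernel_subset: "N \<subseteq> carrier B"
    and coord_kernel: "x \<in> carrier B \<Longrightarrow> x \<in> N \<longleftrightarrow> (\<forall>j<length \<gamma>. monom 1 (\<gamma> ! j) dvd \<rho> x j)"
    and coord_surj: "\<exists>x\<in>carrier B. \<forall>j<length \<gamma>. monom 1 (\<gamma> ! j) dvd \<rho> x j - p j"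

text \<open>Compose the projection to B/N with the isomorphism and choose a polynomial for each
  coordinate. The choice is arbitrary, so \<open>\<rho>\<close> respects the operations only modulo
  the powers of T. Injectivity of the isomorphism identifies the kernel as \<open>N\<close>; its
  surjectivity lets coordinates be prescribed.\<close>

lemma nilp_quotient_T_coordinates:
  fixes B :: "('a::field poly, 'b) module"
  assumes B: "module class_ring B" and N: "submodule class_ring N B"
    and iso: "quot_module B N \<cong>\<^sub>T nilp_module \<gamma>"
  shows "\<exists>\<rho>. T_coordinates B N \<gamma> \<rho>"
proof -
  interpret B: Module.module "class_ring :: 'a poly ring" B by (fact B)
  obtain h where h: "h \<in> LinearCombinations.module_hom class_ring (quot_module B N) (nilp_module \<gamma>)"
    and bij: "bij_betw h (carrier (quot_module B N)) (carrier (nilp_module \<gamma>))"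
    using iso unfolding module_iso_def by blast
  define \<pi> where "\<pi> x = h (N +>\<^bsub>B\<^esub> x)" for x
  define \<rho> where "\<rho> x j = (SOME p. \<pi> x j = T_class (\<gamma> ! j) p)" for x j
  have car: "N +>\<^bsub>B\<^esub> x \<in> carrier (quot_module B N)" if "x \<in> carrier B" for x
    using that by (simp add: quot_module_carrier[OF B N])
  have \<pi>_car: "\<pi> x \<in> (\<Pi>\<^sub>E j\<in>{..<length \<gamma>}. range (T_class (\<gamma> ! j)))" if "x \<in> carrier B" for x
    using LinearCombinations.module_hom_closed[OF h] car[OF that] unfolding \<pi>_def
    by (auto simp: nilp_module_def product_module_def cyclic_module_carrier)
  have \<rho>: "\<pi> x j = T_class (\<gamma> ! j) (\<rho> x j)" if "x \<in> carrier B" "j < length \<gamma>" for x j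
    unfolding \<rho>_def by (rule someI_ex) (use PiE_mem[OF \<pi>_car[OF that(1)], of j] that(2) in auto)
  have add: "\<pi> (x \<oplus>\<^bsub>B\<^esub> y) j = T_class (\<gamma> ! j) (\<rho> x j + \<rho> y j)"
    if "x \<in> carrier B" "y \<in> carrier B" "j < length \<gamma>" for x y j
  proof -
    have "\<pi> (x \<oplus>\<^bsub>B\<^esub> y) = \<pi> x \<oplus>\<^bsub>nilp_module \<gamma>\<^esub> \<pi> y"
      unfolding \<pi>_def using LinearCombinations.module_hom_add[OF h car car] that by (simp add: quot_module_add[OF B N])
    then show ?thesis
      using that by (simp add: nilp_module_def product_module_def \<rho> cyclic_module_add)
  qed
  have smult: "\<pi> (r \<odot>\<^bsub>B\<^esub> x) j = T_class (\<gamma> ! j) (r * \<rho> x j)"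
    if "x \<in> carrier B" "j < length \<gamma>" for r x j
  proof -
    have "\<pi> (r \<odot>\<^bsub>B\<^esub> x) = r \<odot>\<^bsub>nilp_module \<gamma>\<^esub> \<pi> x"
      unfolding \<pi>_def using LinearCombinations.module_hom_smult[OF h _ car, of r] that
      by (simp add: quot_module_smult[OF B N])
    then show ?thesis
      using that by (simp add: nilp_module_def product_module_def \<rho> cyclic_module_smult)
  qed
  have zero: "\<pi> \<zero>\<^bsub>B\<^esub> j = T_class (\<gamma> ! j) 0" if "j < length \<gamma>" for j
    using smult[of "\<zero>\<^bsub>B\<^esub>" j 0] that B.smult_l_null[of "\<zero>\<^bsub>B\<^esub>"] by simp
  have "T_coordinates B N \<gamma> \<rho>"
  proof (rule T_coordinates.intro[OF B T_coordinates_axioms.intro])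
    fix x y j assume "x \<in> carrier B" "y \<in> carrier B" "j < length \<gamma>"
    then show "monom 1 (\<gamma> ! j) dvd \<rho> (x \<oplus>\<^bsub>B\<^esub> y) j - (\<rho> x j + \<rho> y j)"
      using add \<rho> by (simp flip: T_class_eq_iff)
  next
    fix r x j assume "x \<in> carrier B" "j < length \<gamma>"
    then show "monom 1 (\<gamma> ! j) dvd \<rho> (r \<odot>\<^bsub>B\<^esub> x) j - r * \<rho> x j"
      using smult \<rho>[of "r \<odot>\<^bsub>B\<^esub> x" j] by (simp flip: T_class_eq_iff)
  next
    show "N \<subseteq> carrier B" by (rule LinearCombinations.submodule.subset[OF N])
  next
    fix x assume x: "x \<in> carrier B"
    have "x \<in> N \<longleftrightarrow> N +>\<^bsub>B\<^esub> x = N +>\<^bsub>B\<^esub> \<zero>\<^bsub>B\<^esub>"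
      using x by (simp add: quot_module_eq_iff[OF B N] a_minus_def
          B.add.inv_one[folded a_inv_def])
    also have "\<dots> \<longleftrightarrow> \<pi> x = \<pi> \<zero>\<^bsub>B\<^esub>"
      using inj_on_eq_iff[OF bij_betw_imp_inj_on[OF bij] car[OF x] car[OF B.zero_closed]]
      by (simp add: \<pi>_def)
    also have "\<dots> \<longleftrightarrow> (\<forall>j<length \<gamma>. \<pi> x j = \<pi> \<zero>\<^bsub>B\<^esub> j)"
      using PiE_ext[OF \<pi>_car[OF x] \<pi>_car[OF B.zero_closed]] by auto
    also have "\<dots> \<longleftrightarrow> (\<forall>j<length \<gamma>. monom 1 (\<gamma> ! j) dvd \<rho> x j)"
      using x by (simp add: zero \<rho>[OF x] T_class_eq_iff)
    finally show "x \<in> N \<longleftrightarrow> (\<forall>j<length \<gamma>. monom 1 (\<gamma> ! j) dvd \<rho> x j)" .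
  next
    fix p :: "nat \<Rightarrow> 'a poly"
    have "(\<lambda>j\<in>{..<length \<gamma>}. T_class (\<gamma> ! j) (p j)) \<in> carrier (nilp_module \<gamma>)"
      by (auto simp: nilp_module_def product_module_def cyclic_module_carrier)
    then obtain x where x: "x \<in> carrier B" "\<pi> x = (\<lambda>j\<in>{..<length \<gamma>}. T_class (\<gamma> ! j) (p j))"
      using bij_betw_imp_surj_on[OF bij] unfolding \<pi>_def quot_module_carrier[OF B N]
      by (metis (no_types, lifting) image_iff)
    have "monom 1 (\<gamma> ! j) dvd \<rho> x j - p j" if "j < length \<gamma>" for j
      using \<rho>[OF x(1) that] that by (simp add: x(2) flip: T_class_eq_iff)
    then show "\<exists>x\<in>carrier B. \<forall>j<length \<gamma>. monom 1 (\<gamma> ! j) dvd \<rho> x j - p j"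
      using x(1) by blast
  qed
  then show ?thesis by blast
qed

section \<open>The vector space structure of Hom spaces\<close>

text \<open>Comparing dimensions along a linear bijection presupposes these laws. They are inherited
  pointwise from \<open>B'\<close>; extensionality turns agreement on the carrier of
  \<open>B\<close> into equality of morphisms.\<close>

lemma Hom_space_vectorspace:
  fixes B :: "('a::field poly, 'b) module" and B' :: "('a poly, 'c) module"
  assumes B: "module class_ring B" and B': "module class_ring B'"
    and A: "A \<subseteq> carrier B" and A': "submodule class_ring A' B'"
  shows "vectorspace class_ring (Hom_space (A, B) (A', B'))"
proof -
  interpret B: Module.module "class_ring :: 'a poly ring" B by (fact B)
  interpret B': Module.module "class_ring :: 'a poly ring" B' by (fact B')
  interpret A': LinearCombinations.submodule "class_ring :: 'a poly ring" A' B' by (fact A')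
  let ?H = "Hom_space (A, B) (A', B')"
  have mem: "\<phi> \<in> carrier ?H \<longleftrightarrow> \<phi> \<in> LinearCombinations.module_hom class_ring B B' \<and> \<phi> \<in> extensional (carrier B)
      \<and> \<phi> ` A \<subseteq> A'" for \<phi>
    by (simp add: Hom_space_def Hom_S_def)
  have closed: "\<phi> x \<in> carrier B'" if "\<phi> \<in> carrier ?H" "x \<in> carrier B" for \<phi> x
    using that LinearCombinations.module_hom_closed unfolding mem by blast
  have hom_add: "\<phi> (x \<oplus>\<^bsub>B\<^esub> y) = \<phi> x \<oplus>\<^bsub>B'\<^esub> \<phi> y"
    if "\<phi> \<in> carrier ?H" "x \<in> carrier B" "y \<in> carrier B" for \<phi> x y
    using that by (simp add: mem LinearCombinations.module_hom_def)
  have hom_smult: "\<phi> (r \<odot>\<^bsub>B\<^esub> x) = r \<odot>\<^bsub>B'\<^esub> \<phi> x"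
    if "\<phi> \<in> carrier ?H" "x \<in> carrier B" for \<phi> r x
    using that by (simp add: mem LinearCombinations.module_hom_def)
  have eqI: "\<phi> = \<psi>" if "\<phi> \<in> carrier ?H" "\<psi> \<in> carrier ?H" "\<And>x. x \<in> carrier B \<Longrightarrow> \<phi> x = \<psi> x"
    for \<phi> \<psi>
    by (rule extensionalityI[of _ "carrier B"]) (use that in \<open>simp_all add: mem\<close>)
  have ops: "(\<phi> \<oplus>\<^bsub>?H\<^esub> \<psi>) x = \<phi> x \<oplus>\<^bsub>B'\<^esub> \<psi> x" "(c \<odot>\<^bsub>?H\<^esub> \<phi>) x = [:c:] \<odot>\<^bsub>B'\<^esub> \<phi> x"
      "\<zero>\<^bsub>?H\<^esub> x = \<zero>\<^bsub>B'\<^esub>"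
    if "x \<in> carrier B" for \<phi> \<psi> c x
    using that by (simp_all add: Hom_space_def)
  have add: "\<phi> \<oplus>\<^bsub>?H\<^esub> \<psi> \<in> carrier ?H" if \<phi>: "\<phi> \<in> carrier ?H" and \<psi>: "\<psi> \<in> carrier ?H" for \<phi> \<psi>
  proof -
    have "(\<phi> \<oplus>\<^bsub>?H\<^esub> \<psi>) x \<in> A'" if "x \<in> A" for x
    proof -
      have "\<phi> x \<in> A'" "\<psi> x \<in> A'" using \<phi> \<psi> that unfolding mem by auto
      then show ?thesis using that A by (auto simp: ops)
    qed
    moreover have "\<phi> \<oplus>\<^bsub>?H\<^esub> \<psi> \<in> LinearCombinations.module_hom class_ring B B'"
      unfolding LinearCombinations.module_hom_def using \<phi> \<psi>
      by (simp add: Pi_iff ops closed hom_add hom_smult B'.smult_r_distr B'.a_ac)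
    moreover have "\<phi> \<oplus>\<^bsub>?H\<^esub> \<psi> \<in> extensional (carrier B)"
      by (simp add: Hom_space_def)
    ultimately show ?thesis unfolding mem by blast
  qed
  \<comment> \<open>Commutativity of k[T] is what makes a scalar multiple of a morphism k[T]-linear
    again.\<close>
  have smult_commute: "r \<odot>\<^bsub>B'\<^esub> (s \<odot>\<^bsub>B'\<^esub> y) = s \<odot>\<^bsub>B'\<^esub> (r \<odot>\<^bsub>B'\<^esub> y)" if "y \<in> carrier B'" for r s y
    using that B'.smult_assoc1[of r s y] B'.smult_assoc1[of s r y] by (simp add: mult.commute)
  have smult: "c \<odot>\<^bsub>?H\<^esub> \<phi> \<in> carrier ?H" if \<phi>: "\<phi> \<in> carrier ?H" for c \<phi>
  proof -
    have "(c \<odot>\<^bsub>?H\<^esub> \<phi>) x \<in> A'" if "x \<in> A" for x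
    proof -
      have "\<phi> x \<in> A'" using \<phi> that unfolding mem by auto
      then show ?thesis using that A by (auto simp: ops)
    qed
    moreover have "c \<odot>\<^bsub>?H\<^esub> \<phi> \<in> LinearCombinations.module_hom class_ring B B'"
      unfolding LinearCombinations.module_hom_def using \<phi>
      by (simp add: Pi_iff ops closed hom_add hom_smult B'.smult_r_distr smult_commute[of _ "[:c:]"])
    moreover have "c \<odot>\<^bsub>?H\<^esub> \<phi> \<in> extensional (carrier B)"
      by (simp add: Hom_space_def)
    ultimately show ?thesis unfolding mem by blast
  qed
  have zero: "\<zero>\<^bsub>?H\<^esub> \<in> carrier ?H"
  proof -
    have "\<zero>\<^bsub>?H\<^esub> x \<in> A'" if "x \<in> A" for x
      using that A by (auto simp: ops)
    moreover have "\<zero>\<^bsub>?H\<^esub> \<in> LinearCombinations.module_hom class_ring B B'"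
      unfolding LinearCombinations.module_hom_def by (simp add: Pi_iff ops)
    moreover have "\<zero>\<^bsub>?H\<^esub> \<in> extensional (carrier B)"
      by (simp add: Hom_space_def)
    ultimately show ?thesis unfolding mem by blast
  qed
  have "module class_ring ?H"
  proof (rule moduleI)
    show "cring (class_ring :: 'a ring)" by (rule class_cring.is_cring)
    show "abelian_group ?H"
    proof (rule abelian_groupI)
      fix \<phi> assume \<phi>: "\<phi> \<in> carrier ?H"
      have "((- 1) \<odot>\<^bsub>?H\<^esub> \<phi>) \<oplus>\<^bsub>?H\<^esub> \<phi> = \<zero>\<^bsub>?H\<^esub>"
      proof (rule eqI)
        fix x assume x: "x \<in> carrier B"
        have "[:- 1:] \<odot>\<^bsub>B'\<^esub> \<phi> x \<oplus>\<^bsub>B'\<^esub> \<phi> x = [:- 1:] \<odot>\<^bsub>B'\<^esub> \<phi> x \<oplus>\<^bsub>B'\<^esub> 1 \<odot>\<^bsub>B'\<^esub> \<phi> x"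
          using B'.smult_one[OF closed[OF \<phi> x]] by simp
        also have "\<dots> = ([:- 1:] + 1) \<odot>\<^bsub>B'\<^esub> \<phi> x"
          using B'.smult_l_distr[of "[:- 1:]" 1 "\<phi> x"] closed[OF \<phi> x] by simp
        also have "[:- 1:] + 1 = (0 :: 'a poly)"
          by (simp add: one_pCons)
        also have "0 \<odot>\<^bsub>B'\<^esub> \<phi> x = \<zero>\<^bsub>B'\<^esub>"
          using B'.smult_l_null[OF closed[OF \<phi> x]] by simp
        finally show "(((- 1) \<odot>\<^bsub>?H\<^esub> \<phi>) \<oplus>\<^bsub>?H\<^esub> \<phi>) x = \<zero>\<^bsub>?H\<^esub> x"
          using x by (simp add: ops)
      qed (use \<phi> add smult zero in auto)
      then show "\<exists>\<psi>\<in>carrier ?H. \<psi> \<oplus>\<^bsub>?H\<^esub> \<phi> = \<zero>\<^bsub>?H\<^esub>"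
        using smult[OF \<phi>] by blast
    qed (auto intro!: eqI add zero simp: ops closed B'.a_ac)
  next
    fix a b :: 'a and \<phi> assume \<phi>: "\<phi> \<in> carrier ?H"
    show "(a \<oplus>\<^bsub>class_ring\<^esub> b) \<odot>\<^bsub>?H\<^esub> \<phi> = a \<odot>\<^bsub>?H\<^esub> \<phi> \<oplus>\<^bsub>?H\<^esub> b \<odot>\<^bsub>?H\<^esub> \<phi>"
    proof (rule eqI)
      fix x assume x: "x \<in> carrier B"
      show "((a \<oplus>\<^bsub>class_ring\<^esub> b) \<odot>\<^bsub>?H\<^esub> \<phi>) x = (a \<odot>\<^bsub>?H\<^esub> \<phi> \<oplus>\<^bsub>?H\<^esub> b \<odot>\<^bsub>?H\<^esub> \<phi>) x"
        using B'.smult_l_distr[of "[:a:]" "[:b:]" "\<phi> x"] closed[OF \<phi> x] x by (simp add: ops)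
    qed (use \<phi> add smult in auto)
    show "(a \<otimes>\<^bsub>class_ring\<^esub> b) \<odot>\<^bsub>?H\<^esub> \<phi> = a \<odot>\<^bsub>?H\<^esub> (b \<odot>\<^bsub>?H\<^esub> \<phi>)"
    proof (rule eqI)
      fix x assume x: "x \<in> carrier B"
      show "((a \<otimes>\<^bsub>class_ring\<^esub> b) \<odot>\<^bsub>?H\<^esub> \<phi>) x = (a \<odot>\<^bsub>?H\<^esub> (b \<odot>\<^bsub>?H\<^esub> \<phi>)) x"
        using B'.smult_assoc1[of "[:a:]" "[:b:]" "\<phi> x"] closed[OF \<phi> x] x
        by (simp add: ops mult.commute)
    qed (use \<phi> smult in auto)
  next
    fix \<phi> assume \<phi>: "\<phi> \<in> carrier ?H"
    show "\<one>\<^bsub>class_ring\<^esub> \<odot>\<^bsub>?H\<^esub> \<phi> = \<phi>"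
    proof (rule eqI)
      fix x assume x: "x \<in> carrier B"
      show "(\<one>\<^bsub>class_ring\<^esub> \<odot>\<^bsub>?H\<^esub> \<phi>) x = \<phi> x"
        using B'.smult_one[OF closed[OF \<phi> x]] x by (simp add: ops one_pCons)
    qed (use \<phi> smult in auto)
  qed (auto intro!: eqI add smult simp: ops closed B'.smult_r_distr)
  then show ?thesis by (rule vectorspace.intro[OF _ class_field])
qed

section \<open>Morphisms into the pickets with zero submodule\<close>

text \<open>For i = 0 the submodule is generated by the class of T^l, which is zero. Morphisms from
  \<open>(N, B)\<close> to this picket are thus the homomorphisms to k[T]/(T^l) that kill
  \<open>N\<close>.\<close>

lemma picket_0: "picket 0 l = ({T_class l 0}, cyclic_module l)"
proof -
  have "T_class l (r * monom 1 l) = T_class l 0" for r :: "'a::field poly"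
    by (simp add: T_class_eq_iff)
  then have "r \<odot>\<^bsub>cyclic_module l\<^esub> T_class l (monom 1 l) = T_class l 0" for r :: "'a::field poly"
    by (simp add: cyclic_module_smult)
  then show ?thesis
    by (simp add: picket_def flip: T_class_def)
qed

lemma cyclic_module_zero_submodule:
  "submodule class_ring {T_class n (0 :: 'a::field poly)} (cyclic_module n)"
  by (rule LinearCombinations.submodule.intro)
    (auto simp: cyclic_module_module cyclic_module_carrier cyclic_module_zero cyclic_module_add
      cyclic_module_smult)

text \<open>For fixed \<open>u\<close> the admissible \<open>j\<close> are those with \<gamma>_j >=
  l - u; sum over \<open>u\<close> and substitute r = l - u. The pairs will index the free
  coefficients of a homomorphism to k[T]/(T^l).\<close>

lemma card_transpose_part:
  "card {(j, u). j < length \<gamma> \<and> u < l \<and> l \<le> u + \<gamma> ! j} = (\<Sum>r=1..l. transpose_part \<gamma> r)"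
proof -
  have "{(j, u). j < length \<gamma> \<and> u < l \<and> l \<le> u + \<gamma> ! j}
      = prod.swap ` (SIGMA u:{..<l}. {j. j < length \<gamma> \<and> \<gamma> ! j \<ge> l - u})"
    by (force simp: image_iff)
  then have "card {(j, u). j < length \<gamma> \<and> u < l \<and> l \<le> u + \<gamma> ! j}
      = (\<Sum>u<l. transpose_part \<gamma> (l - u))"
    by (simp add: card_image transpose_part_def)
  also have "\<dots> = (\<Sum>r=1..l. transpose_part \<gamma> r)"
    by (rule sum.reindex_bij_witness[of _ "\<lambda>r. l - r" "\<lambda>u. l - u"]) auto
  finally show ?thesis .
qed

context T_coordinates
begin

text \<open>Each error \<open>p j - p' j\<close> is a multiple of T^(\<gamma>_j), so its product
  with \<open>q j\<close> is a multiple of T^l. Hence laws that hold for coordinates only modulo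
  T^(\<gamma>_j) become exact in k[T]/(T^l).\<close>

lemma coord_sum_eqI:
  assumes "\<And>j. j < length \<gamma> \<Longrightarrow> monom 1 (\<gamma> ! j) dvd p j - p' j"
    and "\<And>j. j < length \<gamma> \<Longrightarrow> monom 1 l dvd monom 1 (\<gamma> ! j) * q j"
  shows "T_class l (\<Sum>j<length \<gamma>. p j * q j) = T_class l (\<Sum>j<length \<gamma>. p' j * q j)"
proof -
  have "monom 1 l dvd (\<Sum>j<length \<gamma>. (p j - p' j) * q j)"
  proof (rule dvd_sum)
    fix j assume "j \<in> {..<length \<gamma>}"
    then show "monom 1 l dvd (p j - p' j) * q j"
      using assms by (meson dvd_refl dvd_trans lessThan_iff mult_dvd_mono)
  qed
  then show ?thesis
    by (simp add: T_class_eq_iff left_diff_distrib sum_subtractf)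
qed

text \<open>The hypothesis says that T^(\<gamma>_j) annihilates the class of \<open>q j\<close>, as
  it must for the image of a generator of k[T]/(T^(\<gamma>_j)). The map sends the j-th generator of
  B/N to that class.\<close>

lemma coord_hom:
  assumes q: "\<And>j. j < length \<gamma> \<Longrightarrow> monom 1 l dvd monom 1 (\<gamma> ! j) * q j"
  shows "(\<lambda>x\<in>carrier B. T_class l (\<Sum>j<length \<gamma>. \<rho> x j * q j))
    \<in> carrier (Hom_space (N, B) (picket 0 l))"
proof -
  let ?\<phi> = "\<lambda>x. T_class l (\<Sum>j<length \<gamma>. \<rho> x j * q j)"
  have "?\<phi> (x \<oplus> y) = ?\<phi> x \<oplus>\<^bsub>cyclic_module l\<^esub> ?\<phi> y" if "x \<in> carrier B" "y \<in> carrier B" for x y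
    using coord_sum_eqI[OF coord_add[OF that] q]
    by (simp add: cyclic_module_add distrib_right sum.distrib)
  moreover have "?\<phi> (r \<odot> x) = r \<odot>\<^bsub>cyclic_module l\<^esub> ?\<phi> x" if "x \<in> carrier B" for r x
    using coord_sum_eqI[OF coord_smult[OF that, where r = r] q]
    by (simp add: cyclic_module_smult sum_distrib_left mult.assoc)
  moreover have "?\<phi> x = T_class l 0" if "x \<in> carrier B" "x \<in> N" for x
    using coord_sum_eqI[of "\<rho> x" "\<lambda>_. 0" l q] that coord_kernel q by simp
  moreover note kernel_subset
  ultimately show ?thesis
    by (simp add: picket_0 Hom_space_def Hom_S_def LinearCombinations.module_hom_def
        cyclic_module_carrier Pi_iff image_subset_iff subset_iff[of N])
qed

text \<open>The elements \<open>b k\<close> lift the standard generators of B/N, so together with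
  \<open>N\<close> they generate \<open>B\<close>, and a homomorphism is determined by its values on
  them and on \<open>N\<close>.\<close>

lemma hom_eqI:
  assumes \<phi>: "\<phi> \<in> LinearCombinations.module_hom class_ring B C"
    and \<psi>: "\<psi> \<in> LinearCombinations.module_hom class_ring B C"
    and N: "\<And>x. x \<in> carrier B \<Longrightarrow> x \<in> N \<Longrightarrow> \<phi> x = \<psi> x"
    and b: "\<And>k. k < length \<gamma> \<Longrightarrow> b k \<in> carrier B"
    and b_coord: "\<And>k j. k < length \<gamma> \<Longrightarrow> j < length \<gamma> \<Longrightarrow>
      monom 1 (\<gamma> ! j) dvd \<rho> (b k) j - (if j = k then 1 else 0)"
    and eq: "\<And>k. k < length \<gamma> \<Longrightarrow> \<phi> (b k) = \<psi> (b k)"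
    and x: "x \<in> carrier B"
  shows "\<phi> x = \<psi> x"
proof -
  \<comment> \<open>Induction on a bound \<open>k\<close> from which on all coordinates of
    \<open>x\<close> vanish. Subtracting a multiple of \<open>b k\<close> clears coordinate
    \<open>k\<close>; at bound 0 the element lies in \<open>N\<close>.\<close>
  have "\<phi> x = \<psi> x" if "k \<le> length \<gamma>" "x \<in> carrier B"
    and "\<And>j. k \<le> j \<Longrightarrow> j < length \<gamma> \<Longrightarrow> monom 1 (\<gamma> ! j) dvd \<rho> x j" for k x
    using that
  proof (induction k arbitrary: x)
    case 0
    then show ?case using N coord_kernel by simp
  next
    case (Suc k)
    have k: "k < length \<gamma>" and x: "x \<in> carrier B" using Suc.prems by auto
    define y where "y = x \<oplus> (- \<rho> x k) \<odot> b k"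
    have car: "r \<odot> b k \<in> carrier B" for r using b[OF k] by simp
    have y: "y \<in> carrier B" unfolding y_def using x car by simp
    have "monom 1 (\<gamma> ! j) dvd \<rho> y j" if j: "k \<le> j" "j < length \<gamma>" for j
    proof -
      let ?e = "if j = k then 1 else 0 :: 'a poly"
      \<comment> \<open>The first three summands are the errors of additivity, of scalar
        multiplication and of the coordinates of \<open>b k\<close>. The last one is 0 for j = k and
        otherwise a coordinate of \<open>x\<close> beyond \<open>k\<close>.\<close>
      have "\<rho> y j = (\<rho> y j - (\<rho> x j + \<rho> ((- \<rho> x k) \<odot> b k) j))
          + (\<rho> ((- \<rho> x k) \<odot> b k) j - (- \<rho> x k) * \<rho> (b k) j)
          + (- \<rho> x k) * (\<rho> (b k) j - ?e) + (\<rho> x j - \<rho> x k * ?e)"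
        by (simp add: algebra_simps)
      moreover have "monom 1 (\<gamma> ! j) dvd \<rho> y j - (\<rho> x j + \<rho> ((- \<rho> x k) \<odot> b k) j)"
        unfolding y_def by (rule coord_add[OF x car j(2)])
      moreover have "monom 1 (\<gamma> ! j) dvd \<rho> ((- \<rho> x k) \<odot> b k) j - (- \<rho> x k) * \<rho> (b k) j"
        by (rule coord_smult[OF b[OF k] j(2)])
      moreover have "monom 1 (\<gamma> ! j) dvd (- \<rho> x k) * (\<rho> (b k) j - ?e)"
        by (rule dvd_mult[OF b_coord[OF k j(2)]])
      moreover have "monom 1 (\<gamma> ! j) dvd \<rho> x j - \<rho> x k * ?e"
        using Suc.prems(3)[of j] j by auto
      ultimately show ?thesis by (metis dvd_add)
    qed
    then have "\<phi> y = \<psi> y" using Suc.IH[of y] y k by simp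
    moreover have "x = y \<oplus> \<rho> x k \<odot> b k"
    proof -
      have "(- \<rho> x k) \<odot> b k \<oplus> \<rho> x k \<odot> b k = \<zero>"
        using smult_l_distr[of "- \<rho> x k" "\<rho> x k" "b k"] smult_l_null[OF b[OF k]] b[OF k] by simp
      then show ?thesis unfolding y_def using x car by (simp add: a_assoc)
    qed
    moreover have "\<phi> (y \<oplus> \<rho> x k \<odot> b k) = \<psi> (y \<oplus> \<rho> x k \<odot> b k)"
      using \<phi> \<psi> y b[OF k] eq[OF k] car[of "\<rho> x k"] \<open>\<phi> y = \<psi> y\<close>
      by (simp add: LinearCombinations.module_hom_def)
    ultimately show ?case by simp
  qed
  from this[of "length \<gamma>" x] x show ?thesis by simp
qed

text \<open>For \<open>k\<close> beyond the length of \<gamma> the condition asks all coordinates to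
  vanish, so \<open>b\<close> can be chosen as a total function.\<close>

lemma coord_basis:
  "\<exists>b. \<forall>k. b k \<in> carrier B \<and> (\<forall>j<length \<gamma>. monom 1 (\<gamma> ! j) dvd \<rho> (b k) j - (if j = k then 1 else 0))"
  using coord_surj[of "\<lambda>j. if j = _ then 1 else 0"] by (intro choice) blast

text \<open>A morphism vanishing on \<open>N\<close> is given by the images \<open>q\<^sub>j\<close> of generators of the cyclic summands
  of \<open>B/N\<close>, subject to \<open>T\<^sup>l\<close> dividing \<open>T\<close> to the power \<open>\<gamma>\<^sub>j\<close> times \<open>q\<^sub>j\<close>.  The free coefficients of \<open>q\<^sub>j\<close> are those
  in the degrees \<open>u < l\<close> with \<open>l \<le> u + \<gamma>\<^sub>j\<close>.\<close>
lemma dim_Hom_picket_0: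
  "dim_Hom (N, B) (picket 0 l) = (\<Sum>r=1..l. transpose_part \<gamma> r)"
proof -
  let ?H = "Hom_space (N, B) (picket 0 l)"
  define D where "D = {(j, u). j < length \<gamma> \<and> u < l \<and> l \<le> u + \<gamma> ! j}"
  define d where "d = card D"
  have "D \<subseteq> {..<length \<gamma>} \<times> {..<l}" by (auto simp: D_def)
  then have "finite D" by (rule finite_subset) simp
  \<comment> \<open>\<open>h\<close> numbers the free coefficients, so that a vector of length
    \<open>d\<close> can list them.\<close>
  then obtain h where h: "bij_betw h D {0..<d}"
    unfolding d_def using ex_bij_betw_finite_nat by blast
  have hD: "h (j, u) < d" if "j < length \<gamma>" "u < l" "l \<le> u + \<gamma> ! j" for j u
    using bij_betw_apply[OF h, of "(j, u)"] that by (simp add: D_def)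
  \<comment> \<open>The polynomial of degree below \<open>l\<close> whose free coefficients are read
    from \<open>v\<close> and whose other coefficients are 0.\<close>
  define q where "q v j = (\<Sum>u<l. monom (if l \<le> u + \<gamma> ! j then v $ h (j, u) else 0) u)"
    for v :: "'a vec" and j
  have coeff_q: "coeff (q v j) u = (if u < l \<and> l \<le> u + \<gamma> ! j then v $ h (j, u) else 0)" for v j u
    by (simp add: q_def coeff_sum)
  \<comment> \<open>A coefficient of the product below degree \<open>l\<close> is 0 or comes from a
    degree u with u + \<gamma>_j < l, where \<open>q v j\<close> has coefficient 0.\<close>
  have q_dvd: "monom 1 l dvd monom 1 (\<gamma> ! j) * q v j" for v j
    by (auto simp: monom_1_dvd_iff' coeff_monom_mult coeff_q)
  define \<Phi> where "\<Phi> v = (\<lambda>x\<in>carrier B. T_class l (\<Sum>j<length \<gamma>. \<rho> x j * q v j))" for v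
  have \<Phi>: "\<Phi> v \<in> carrier ?H" for v
    unfolding \<Phi>_def by (rule coord_hom) (rule q_dvd)
  obtain b where b: "\<And>k. b k \<in> carrier B"
    and b_coord: "\<And>k j. j < length \<gamma> \<Longrightarrow>
      monom 1 (\<gamma> ! j) dvd \<rho> (b k) j - (if j = k then 1 else 0)"
    using coord_basis by blast
  have \<Phi>_b: "\<Phi> v (b k) = T_class l (q v k)" if "k < length \<gamma>" for v k
  proof -
    have "\<Phi> v (b k) = T_class l (\<Sum>j<length \<gamma>. (if j = k then 1 else 0) * q v j)"
      unfolding \<Phi>_def restrict_apply'[OF b] by (rule coord_sum_eqI[OF b_coord q_dvd])
    also have "(\<Sum>j<length \<gamma>. (if j = k then 1 else 0) * q v j) = (\<Sum>j<length \<gamma>. if j = k then q v j else 0)"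
      by (rule sum.cong) auto
    finally show ?thesis using that by simp
  qed
  \<comment> \<open>Evaluating at \<open>b j\<close> recovers \<open>q v j\<close> modulo T^l, and
    with it every entry of \<open>v\<close>.\<close>
  have inj: "inj_on \<Phi> (carrier_vec d)"
  proof (rule inj_onI)
    fix v w :: "'a vec"
    assume vw: "v \<in> carrier_vec d" "w \<in> carrier_vec d" "\<Phi> v = \<Phi> w"
    have "v $ i = w $ i" if "i < d" for i
    proof -
      obtain j u where ju: "h (j, u) = i" "j < length \<gamma>" "u < l" "l \<le> u + \<gamma> ! j"
      proof -
        have "i \<in> h ` D" using bij_betw_imp_surj_on[OF h] \<open>i < d\<close> by simp
        then show ?thesis using that unfolding D_def by blast
      qed
      have "monom 1 l dvd q v j - q w j"
        using \<Phi>_b[OF ju(2), of v] \<Phi>_b[OF ju(2), of w] vw(3)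
        by (simp flip: T_class_eq_iff)
      then have "coeff (q v j - q w j) u = 0"
        using ju(3) by (simp add: monom_1_dvd_iff')
      then show ?thesis using ju by (simp add: coeff_q)
    qed
    then show "v = w" using vw by (intro eq_vecI) auto
  qed
  have surj: "\<Phi> ` carrier_vec d = carrier ?H"
  proof (intro equalityI subsetI)
    fix \<phi> assume "\<phi> \<in> carrier ?H"
    then have \<phi>: "\<phi> \<in> LinearCombinations.module_hom class_ring B (cyclic_module l)"
      and ext: "\<phi> \<in> extensional (carrier B)" and \<phi>_N: "\<And>x. x \<in> N \<Longrightarrow> \<phi> x = T_class l 0"
      by (auto simp: Hom_space_def Hom_S_def picket_0)
    have "\<exists>p. \<phi> (b k) = T_class l p" for k
      using funcset_mem[OF LinearCombinations.module_hom_closed[OF \<phi>] b[of k]]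
      by (auto simp: cyclic_module_carrier)
    then obtain p where p: "\<And>k. \<phi> (b k) = T_class l (p k)" by metis
    \<comment> \<open>T^(\<gamma>_k) times \<open>b k\<close> has all coordinates zero, so it lies
      in \<open>N\<close> and is killed by \<open>\<phi>\<close>.\<close>
    have p_dvd: "monom 1 l dvd monom 1 (\<gamma> ! k) * p k" if k: "k < length \<gamma>" for k
    proof -
      have "monom 1 (\<gamma> ! j) dvd \<rho> (monom 1 (\<gamma> ! k) \<odot> b k) j" if j: "j < length \<gamma>" for j
      proof -
        have "monom 1 (\<gamma> ! j) dvd monom 1 (\<gamma> ! k) * \<rho> (b k) j"
          using b_coord[OF j, of k] by (cases "j = k") auto
        moreover have "monom 1 (\<gamma> ! j) dvd
            \<rho> (monom 1 (\<gamma> ! k) \<odot> b k) j - monom 1 (\<gamma> ! k) * \<rho> (b k) j"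
          by (rule coord_smult[OF b j])
        ultimately show ?thesis by (metis dvd_add diff_add_cancel)
      qed
      then have "monom 1 (\<gamma> ! k) \<odot> b k \<in> N" using coord_kernel b by simp
      then have "T_class l (monom 1 (\<gamma> ! k) * p k) = T_class l 0"
        using \<phi>_N LinearCombinations.module_hom_smult[OF \<phi> _ b, of "monom 1 (\<gamma> ! k)" k]
        by (simp add: p cyclic_module_smult)
      then show ?thesis by (simp add: T_class_eq_iff)
    qed
    \<comment> \<open>Collects the free coefficients of the \<open>p j\<close>. By
      \<open>p_dvd\<close> the other coefficients below degree \<open>l\<close> are 0, so
      \<open>q v j\<close> and \<open>p j\<close> agree modulo T^l.\<close>
    define v where "v = vec d (\<lambda>i. case the_inv_into D h i of (j, u) \<Rightarrow> coeff (p j) u)"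
    have v: "v $ h (j, u) = coeff (p j) u" if "j < length \<gamma>" "u < l" "l \<le> u + \<gamma> ! j" for j u
      using hD[OF that] the_inv_into_f_f[OF bij_betw_imp_inj_on[OF h], of "(j, u)"] that
      by (simp add: v_def D_def)
    have "T_class l (q v k) = T_class l (p k)" if k: "k < length \<gamma>" for k
    proof -
      have "coeff (q v k) u = coeff (p k) u" if u: "u < l" for u
      proof (cases "l \<le> u + \<gamma> ! k")
        case True
        then show ?thesis using k u by (simp add: coeff_q v)
      next
        case False
        then have "coeff (monom 1 (\<gamma> ! k) * p k) (u + \<gamma> ! k) = 0"
          using p_dvd[OF k] unfolding monom_1_dvd_iff' by simp
        then show ?thesis using False by (simp add: coeff_q coeff_monom_mult)
      qed
      then show ?thesis by (simp add: T_class_eq_iff monom_1_dvd_iff')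
    qed
    then have agree: "\<Phi> v (b k) = \<phi> (b k)" if "k < length \<gamma>" for k
      using \<Phi>_b p that by simp
    have \<Phi>v: "\<Phi> v \<in> LinearCombinations.module_hom class_ring B (cyclic_module l)"
      "\<Phi> v \<in> extensional (carrier B)" "\<And>x. x \<in> N \<Longrightarrow> \<Phi> v x = T_class l 0"
      using \<Phi>[of v] by (auto simp: Hom_space_def Hom_S_def picket_0)
    have "\<Phi> v = \<phi>"
    proof (rule extensionalityI[OF \<Phi>v(2) ext])
      show "\<Phi> v x = \<phi> x" if "x \<in> carrier B" for x
        by (rule hom_eqI[where b = b, OF \<Phi>v(1) \<phi> _ b b_coord agree that])
          (simp_all add: \<Phi>v(3) \<phi>_N)
    qed
    moreover have "v \<in> carrier_vec d" by (simp add: v_def)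
    ultimately show "\<phi> \<in> \<Phi> ` carrier_vec d" by blast
  qed (use \<Phi> in auto)
  \<comment> \<open>Vector operations are entrywise only at indices below the dimension;
    \<open>hD\<close> keeps the indices in that range.\<close>
  have q_add: "q (v + w) j = q v j + q w j"
    if "v \<in> carrier_vec d" "w \<in> carrier_vec d" "j < length \<gamma>" for v w j
    using that hD by (intro poly_eqI) (simp add: coeff_q)
  have q_smult: "q (c \<cdot>\<^sub>v v) j = [:c:] * q v j"
    if "v \<in> carrier_vec d" "j < length \<gamma>" for c v j
    using that hD by (intro poly_eqI) (simp add: coeff_q)
  have "\<Phi> \<in> LinearCombinations.module_hom class_ring (module_vec TYPE('a) d) ?H"
    unfolding LinearCombinations.module_hom_def
  proof (intro CollectI conjI allI impI)
    show "\<Phi> \<in> carrier (module_vec TYPE('a) d) \<rightarrow> carrier ?H" using \<Phi> by auto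
  next
    fix v w assume "v \<in> carrier (module_vec TYPE('a) d) \<and> w \<in> carrier (module_vec TYPE('a) d)"
    then show "\<Phi> (v \<oplus>\<^bsub>module_vec TYPE('a) d\<^esub> w) = \<Phi> v \<oplus>\<^bsub>?H\<^esub> \<Phi> w"
      by (auto simp: module_vec_simps \<Phi>_def Hom_space_def picket_0 cyclic_module_add q_add
          distrib_left sum.distrib intro!: restrict_ext)
  next
    fix c :: 'a and v
    assume "c \<in> carrier class_ring \<and> v \<in> carrier (module_vec TYPE('a) d)"
    then show "\<Phi> (c \<odot>\<^bsub>module_vec TYPE('a) d\<^esub> v) = c \<odot>\<^bsub>?H\<^esub> \<Phi> v"
      by (auto simp: module_vec_simps \<Phi>_def Hom_space_def picket_0 cyclic_module_smult q_smult
          sum_distrib_left ac_simps intro!: restrict_ext)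
  qed
  moreover have H: "vectorspace class_ring ?H"
    unfolding picket_0
    by (rule Hom_space_vectorspace[OF module_axioms cyclic_module_module kernel_subset cyclic_module_zero_submodule])
  ultimately have "linear_map class_ring (module_vec TYPE('a) d) ?H \<Phi>"
    by (intro linear_map.intro mod_hom.intro mod_hom_axioms.intro vec_vs)
      (auto intro: vectorspace.axioms vec_vs)
  from linear_map.dim_eq[OF this vec_space.fin_dim] inj surj
  have "vectorspace.dim class_ring (module_vec TYPE('a) d) = vectorspace.dim class_ring ?H"
    by (simp add: module_vec_simps)
  then show ?thesis
    by (simp add: vec_space.dim_is_n d_def D_def card_transpose_part)
qed

end

section \<open>Reduction of all pickets to those with zero submodule\<close>

text \<open>Since T^(l-i) divides T^l, divisibility by it does not depend on the representative
  \<open>p\<close>. For i >= l the truncated exponent is 0 and the submodule is everything.\<close>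

lemma fst_picket: "T_class l p \<in> fst (picket i l) \<longleftrightarrow> monom 1 (l - i) dvd p"
proof -
  have fst: "fst (picket i l) = range (\<lambda>r :: 'a poly. T_class l (r * monom 1 (l - i)))"
    by (simp add: picket_def cyclic_module_smult flip: T_class_def)
  show ?thesis
  proof
    assume "T_class l p \<in> fst (picket i l)"
    then obtain r where "monom 1 l dvd p - r * monom 1 (l - i)"
      unfolding fst by (auto simp: T_class_eq_iff)
    moreover have "monom 1 (l - i) dvd (monom 1 l :: 'a poly)"
      by (simp add: monom_1_dvd_iff')
    ultimately have "monom 1 (l - i) dvd p - r * monom 1 (l - i)"
      by (rule dvd_trans[rotated])
    from dvd_add[OF this dvd_triv_right[of _ r]] show "monom 1 (l - i) dvd p" by simp
  next
    assume "monom 1 (l - i) dvd p"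
    then show "T_class l p \<in> fst (picket i l)"
      unfolding fst by (auto elim: dvdE simp: mult.commute)
  qed
qed

text \<open>A homomorphism maps \<open>A\<close> into \<open>(T\<^bsup>l-i\<^esup>)\<close> iff it kills \<open>T\<^sup>iA\<close>, because
  \<open>(T\<^bsup>l-i\<^esup>)\<close> is the annihilator of \<open>T\<^sup>i\<close> in \<open>k[T]/(T\<^sup>l)\<close>; the latter is everything for \<open>i \<ge> l\<close>.\<close>
lemma Hom_space_picket:
  fixes B :: "('a::field poly, 'b) module"
  assumes A: "A \<subseteq> carrier B"
  shows "Hom_space (A, B) (picket (min i l) l) = Hom_space ((\<lambda>a. monom 1 i \<odot>\<^bsub>B\<^esub> a) ` A, B) (picket 0 l)"
proof -
  \<comment> \<open>Both sides say that the coefficients of \<open>p\<close> below degree l - i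
    vanish; for i >= l both hold for every \<open>p\<close>.\<close>
  have dvd: "monom 1 (l - min i l) dvd p \<longleftrightarrow> monom 1 l dvd monom 1 i * p" for p :: "'a poly"
  proof -
    have "monom 1 l dvd monom 1 i * p \<longleftrightarrow> (\<forall>k<l. i \<le> k \<longrightarrow> coeff p (k - i) = 0)"
      by (auto simp: monom_1_dvd_iff' coeff_monom_mult)
    also have "\<dots> \<longleftrightarrow> (\<forall>k<l - i. coeff p k = 0)"
      by (metis add_diff_cancel_right' diff_less_mono le_add2 less_diff_conv)
    also have "\<dots> \<longleftrightarrow> monom 1 (l - min i l) dvd p"
      by (simp add: monom_1_dvd_iff' min_def)
    finally show ?thesis ..
  qed
  have "\<phi> a \<in> fst (picket (min i l) l) \<longleftrightarrow> \<phi> (monom 1 i \<odot>\<^bsub>B\<^esub> a) \<in> fst (picket 0 l)"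
    if \<phi>: "\<phi> \<in> LinearCombinations.module_hom class_ring B (cyclic_module l)" and "a \<in> A" for \<phi> a
  proof -
    have a: "a \<in> carrier B" using A that by blast
    obtain p where p: "\<phi> a = T_class l p"
      using funcset_mem[OF LinearCombinations.module_hom_closed[OF \<phi>] a]
      by (auto simp: cyclic_module_carrier)
    have "\<phi> (monom 1 i \<odot>\<^bsub>B\<^esub> a) = T_class l (monom 1 i * p)"
      using LinearCombinations.module_hom_smult[OF \<phi> _ a, of "monom 1 i"]
      by (simp add: p cyclic_module_smult)
    then show ?thesis by (simp add: p fst_picket dvd)
  qed
  then have "Hom_S (A, B) (fst (picket (min i l) l), cyclic_module l)
      = Hom_S ((\<lambda>a. monom 1 i \<odot>\<^bsub>B\<^esub> a) ` A, B) (fst (picket 0 l), cyclic_module l)"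
    unfolding Hom_S_def by (auto simp: image_subset_iff)
  then have "Hom_space (A, B) (fst (picket (min i l) l), cyclic_module l)
      = Hom_space ((\<lambda>a. monom 1 i \<odot>\<^bsub>B\<^esub> a) ` A, B) (fst (picket 0 l), cyclic_module l)"
    by (simp add: Hom_space_def)
  moreover have "(fst (picket j l), cyclic_module l) = (picket j l :: ('a, 'a poly set) emb)" for j
    by (simp add: picket_def)
  ultimately show ?thesis by simp
qed

section \<open>The submodules T^iA and the comparison with tableaux\<close>

text \<open>Closure under scalars rests on commutativity of k[T]. With p = T^i this allows B/T^iA to
  be treated as a quotient module.\<close>

lemma smult_image_submodule:
  fixes B :: "('a::field poly, 'b) module"
  assumes A: "submodule class_ring A B"
  shows "submodule class_ring ((\<lambda>a. p \<odot>\<^bsub>B\<^esub> a) ` A) B"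
proof -
  interpret A: LinearCombinations.submodule "class_ring :: 'a poly ring" A B by (fact A)
  interpret B: Module.module "class_ring :: 'a poly ring" B by (fact A.module)
  have car: "a \<in> carrier B" if "a \<in> A" for a using that A.subset by blast
  show ?thesis
  proof (rule LinearCombinations.submodule.intro)
    show "module class_ring B" by (fact A.module)
    show "(\<lambda>a. p \<odot>\<^bsub>B\<^esub> a) ` A \<subseteq> carrier B" using car by auto
    show "\<zero>\<^bsub>B\<^esub> \<in> (\<lambda>a. p \<odot>\<^bsub>B\<^esub> a) ` A"
      using B.smult_r_null[of p] A.zero_closed by (metis UNIV_I image_eqI partial_object.select_convs(1))
  next
    fix v w assume "v \<in> (\<lambda>a. p \<odot>\<^bsub>B\<^esub> a) ` A" "w \<in> (\<lambda>a. p \<odot>\<^bsub>B\<^esub> a) ` A"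
    then obtain a b where ab: "a \<in> A" "b \<in> A" "v = p \<odot>\<^bsub>B\<^esub> a" "w = p \<odot>\<^bsub>B\<^esub> b" by blast
    then have "v \<oplus>\<^bsub>B\<^esub> w = p \<odot>\<^bsub>B\<^esub> (a \<oplus>\<^bsub>B\<^esub> b)"
      using B.smult_r_distr[of p a b] car by simp
    then show "v \<oplus>\<^bsub>B\<^esub> w \<in> (\<lambda>a. p \<odot>\<^bsub>B\<^esub> a) ` A"
      using A.m_closed[OF ab(1,2)] by blast
  next
    fix c v assume "v \<in> (\<lambda>a. p \<odot>\<^bsub>B\<^esub> a) ` A"
    then obtain a where a: "a \<in> A" "v = p \<odot>\<^bsub>B\<^esub> a" by blast
    then have "c \<odot>\<^bsub>B\<^esub> v = p \<odot>\<^bsub>B\<^esub> (c \<odot>\<^bsub>B\<^esub> a)"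
      using B.smult_assoc1[of c p a] B.smult_assoc1[of p c a] car by (simp add: mult.commute)
    moreover have "c \<odot>\<^bsub>B\<^esub> a \<in> A" using A.smult_closed[of c a] a by simp
    ultimately show "c \<odot>\<^bsub>B\<^esub> v \<in> (\<lambda>a. p \<odot>\<^bsub>B\<^esub> a) ` A" by blast
  qed
qed

lemma nth_le_first_part:
  assumes "is_partition \<alpha>" "j < length \<alpha>"
  shows "\<alpha> ! j \<le> first_part \<alpha>"
  using assms by (cases \<alpha>; cases j) (auto simp: is_partition_def first_part_def)

text \<open>No part of \<alpha> exceeds the first, so T^i kills every summand k[T]/(T^(\<alpha>_j))
  and therefore \<open>A\<close>. It follows that T^iA no longer changes once i reaches
  \<alpha>_1.\<close>

lemma T_power_eq_zero:
  fixes B :: "('a::field poly, 'b) module"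
  assumes A: "submodule class_ring A B" and iso: "B\<lparr>carrier := A\<rparr> \<cong>\<^sub>T nilp_module \<alpha>"
    and \<alpha>: "is_partition \<alpha>" and i: "first_part \<alpha> \<le> i" and a: "a \<in> A"
  shows "monom 1 i \<odot>\<^bsub>B\<^esub> a = \<zero>\<^bsub>B\<^esub>"
proof -
  interpret A: LinearCombinations.submodule "class_ring :: 'a poly ring" A B by (fact A)
  interpret B: Module.module "class_ring :: 'a poly ring" B by (fact A.module)
  obtain h where h: "h \<in> LinearCombinations.module_hom class_ring (B\<lparr>carrier := A\<rparr>) (nilp_module \<alpha>)"
    and bij: "bij_betw h A (carrier (nilp_module \<alpha>))"
    using iso unfolding module_iso_def by auto
  have smult: "h (r \<odot>\<^bsub>B\<^esub> a) = r \<odot>\<^bsub>nilp_module \<alpha>\<^esub> h a" for r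
    using LinearCombinations.module_hom_smult[OF h, of r a] a by simp
  \<comment> \<open>Zero is written as \<open>0\<close> times \<open>h a\<close>, so that
    compatibility of \<open>h\<close> with scalars and its injectivity suffice.\<close>
  have "monom 1 i \<odot>\<^bsub>cyclic_module (\<alpha> ! j)\<^esub> h a j = 0 \<odot>\<^bsub>cyclic_module (\<alpha> ! j)\<^esub> h a j"
    if j: "j < length \<alpha>" for j
  proof -
    have "h a \<in> carrier (nilp_module \<alpha>)"
      using bij_betw_apply[OF bij a] .
    then have "h a j \<in> range (T_class (\<alpha> ! j))"
      using j by (auto simp: nilp_module_def product_module_def cyclic_module_carrier)
    then obtain p where p: "h a j = T_class (\<alpha> ! j) p" by blast
    have "\<alpha> ! j \<le> i" using nth_le_first_part[OF \<alpha> j] i by simp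
    then have "monom 1 (\<alpha> ! j) dvd (monom 1 i :: 'a poly)"
      by (simp add: monom_1_dvd_iff')
    then show ?thesis
      by (simp add: p cyclic_module_smult T_class_eq_iff)
  qed
  then have "h (monom 1 i \<odot>\<^bsub>B\<^esub> a) = h (0 \<odot>\<^bsub>B\<^esub> a)"
    unfolding smult by (auto simp: nilp_module_def product_module_def intro: restrict_ext)
  moreover have "monom 1 i \<odot>\<^bsub>B\<^esub> a \<in> A" "0 \<odot>\<^bsub>B\<^esub> a \<in> A"
    using A.smult_closed[of _ a] a by simp_all
  ultimately have "monom 1 i \<odot>\<^bsub>B\<^esub> a = 0 \<odot>\<^bsub>B\<^esub> a"
    using bij_betw_imp_inj_on[OF bij] by (simp add: inj_on_eq_iff)
  also have "\<dots> = \<zero>\<^bsub>B\<^esub>"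
    using B.smult_l_null[of a] a A.subset by auto
  finally show ?thesis .
qed

text \<open>The two minima fit an arbitrary \<open>i\<close> to the two index ranges: pickets need i
  <= l, the tableau ends at \<alpha>_1. Beyond l the power T^i already annihilates k[T]/(T^l);
  beyond \<alpha>_1 it annihilates \<open>A\<close>.\<close>

lemma dim_Hom_picket:
  assumes X: "embedding X" and \<Gamma>: "has_LR_tableau X \<alpha> \<beta> \<gamma> \<Gamma>"
  shows "dim_Hom X (picket (min i l) l)
    = (\<Sum>r=1..l. transpose_part (\<Gamma> ! min i (first_part \<alpha>)) r)"
proof -
  obtain A B where AB: "X = (A, B)" by (cases X)
  have B: "module class_ring B" and A: "submodule class_ring A B"
    using X by (auto simp: AB embedding_def)
  have \<alpha>: "is_partition \<alpha>" and iso: "B\<lparr>carrier := A\<rparr> \<cong>\<^sub>T nilp_module \<alpha>"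
    using \<Gamma> by (auto simp: AB has_LR_tableau_def has_shape_def)
  let ?N = "\<lambda>i. (\<lambda>a. monom 1 i \<odot>\<^bsub>B\<^esub> a) ` A"
  let ?j = "min i (first_part \<alpha>)"
  have N: "?N i = ?N ?j"
  proof (cases "i \<le> first_part \<alpha>")
    case False
    then show ?thesis
      using T_power_eq_zero[OF A iso \<alpha>] by (intro image_cong) simp_all
  qed simp
  have "quot_module B (?N ?j) \<cong>\<^sub>T nilp_module (\<Gamma> ! ?j)"
    using \<Gamma> by (simp add: AB has_LR_tableau_def)
  then obtain \<rho> where "T_coordinates B (?N ?j) (\<Gamma> ! ?j) \<rho>"
    using nilp_quotient_T_coordinates[OF B smult_image_submodule[OF A]] by blast
  then have "dim_Hom (?N ?j, B) (picket 0 l) = (\<Sum>r=1..l. transpose_part (\<Gamma> ! ?j) r)"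
    by (rule T_coordinates.dim_Hom_picket_0)
  then show ?thesis
    unfolding AB Hom_space_picket[OF LinearCombinations.submodule.subset[OF A]] N .
qed

theorem proposition4p2:
  fixes X :: "('a::alg_closed_field, 'b) emb" and X' :: "('a, 'c) emb"
    and \<alpha> \<beta> \<gamma> :: "nat list" and \<Gamma> \<Gamma>' :: "nat list list"
  assumes "embedding X" and "embedding X'"
    and "has_LR_tableau X \<alpha> \<beta> \<gamma> \<Gamma>" and "has_LR_tableau X' \<alpha> \<beta> \<gamma> \<Gamma>'"
  shows "\<Gamma> \<le>\<^sub>d\<^sub>o\<^sub>m \<Gamma>' \<longleftrightarrow>
    (\<forall>l i. 1 \<le> l \<and> i \<le> l \<longrightarrow> dim_Hom X (picket i l) \<le> dim_Hom X' (picket i l))"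
proof -
  let ?t = "first_part \<alpha>"
  let ?S = "\<lambda>\<gamma> l. \<Sum>r=1..l. transpose_part \<gamma> r"
  note dim = dim_Hom_picket[OF assms(1,3)] dim_Hom_picket[OF assms(2,4)]
  have len: "length \<Gamma> = Suc ?t" "length \<Gamma>' = Suc ?t"
    using assms(3,4) by (simp_all add: has_LR_tableau_def)
  have "\<Gamma> \<le>\<^sub>d\<^sub>o\<^sub>m \<Gamma>' \<longleftrightarrow> (\<forall>i\<le>?t. \<forall>l. ?S (\<Gamma> ! i) l \<le> ?S (\<Gamma>' ! i) l)"
    by (simp add: dom_le_def list_all2_conv_all_nth len nat_le_def less_Suc_eq_le)
  \<comment> \<open>As \<open>i\<close> runs over all naturals, \<open>min i ?t\<close> runs over
    exactly the indices of the tableau, which frees the range of \<open>i\<close> from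
    \<alpha>.\<close>
  also have "\<dots> \<longleftrightarrow> (\<forall>i l. ?S (\<Gamma> ! min i ?t) l \<le> ?S (\<Gamma>' ! min i ?t) l)"
    by (metis min.absorb1 min.cobounded2)
  also have "\<dots> \<longleftrightarrow> (\<forall>i l. dim_Hom X (picket (min i l) l) \<le> dim_Hom X' (picket (min i l) l))"
    by (simp only: dim)
  also have "\<dots> \<longleftrightarrow> (\<forall>l i. 1 \<le> l \<and> i \<le> l \<longrightarrow> dim_Hom X (picket i l) \<le> dim_Hom X' (picket i l))"
  proof -
    \<comment> \<open>The pickets in the statement have l >= 1; at l = 0 both dimensions are empty
      sums.\<close>
    have "dim_Hom X (picket (min i 0) 0) \<le> dim_Hom X' (picket (min i 0) 0)" for i
      by (simp only: dim) simp
    then show ?thesis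
      by (metis less_one linorder_not_less min.absorb1 min.cobounded2)
  qed
  finally show ?thesis .
qed

end
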